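(* Let $\vec w=(w_1,w_2)$ and $\underline{\vec w}=(w_2,x\,w_1)$, and let $\Omega:=S_{\vec w}S_{\underline{\vec w}}^{-1}$ be the connection matrix. Then $\Omega$ is lower bidiagonal with $$\Omega_{n,n}=1,\qquad \Omega_{n+1,n}=\frac{H_{\vec w,n+1}}{H_{\underline{\vec w},n}},\qquad n\in\mathbb N_0,$$ and all other entries zero. Moreover, the following connection formulas hold: $$\Omega B_{\underline{\vec w}}=B_{\vec w},\qquad \Omega^\top A_{1,\vec w}=x\,A_{2,\underline{\vec w}},\qquad \Omega^\top A_{2,\vec w}=A_{1,\underline{\vec w}},\qquad \Omega^\top Q_{\vec w}=Q_{\underline{\vec w}} .$$
   Context: Let $\Delta\subset\mathbb R$ be an interval, $\mu$ a measure supported on $\Delta$, and $w_1,w_2$ weight functions on $\Delta$ with all moments $\int_\Delta x^kw_a\,\mathrm d\mu$ finite. All vectors and matrices are semi-infinite, indexed by $0,1,2,\dots$. Put $X(x)=(1,x,x^2,\dots)^\top$, $X_1(x)=(1,0,x,0,x^2,0,\dots)^\top$, $X_2(x)=(0,1,0,x,0,x^2,\dots)^\top$. For a pair of weights $\vec u=(u_1,u_2)$, the moment matrix is $g_{\vec u}=\int_\Delta X(x)\big(X_1(x)u_1(x)+X_2(x)u_2(x)\big)^\top\mathrm d\mu(x)$. It is assumed that for both $\vec u=\vec w$ and $\vec u=\underline{\vec w}$ the matrix $g_{\vec u}$ has a Gauss–Borel factorization $g_{\vec u}=S_{\vec u}^{-1}H_{\vec u}\tilde S_{\vec u}^{-\top}$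 with $S_{\vec u},\tilde S_{\vec u}$ lower unitriangular and $H_{\vec u}=\operatorname{diag}(H_{\vec u,0},H_{\vec u,1},\dots)$, all entries nonzero. Then $B_{\vec u}=S_{\vec u}X$, $A_{a,\vec u}=H_{\vec u}^{-1}\tilde S_{\vec u}X_a$ for $a\in\{1,2\}$, and $Q_{\vec u}=u_1A_{1,\vec u}+u_2A_{2,\vec u}$. *)

theory Defs
  imports "HOL-Analysis.Analysis" "HOL-Library.Groups_Big_Fun"
begin

type_synonym smat = "nat \<Rightarrow> nat \<Rightarrow> real"
type_synonym svec = "nat \<Rightarrow> real"

(* Sum_any sums over the indices with nonzero summand and is 0 if there are infinitely many of
   them.  Every entry is a finite sum if the left factor has finitely supported rows (for instance
   a lower triangular matrix or the transpose of a lower bidiagonal one). *)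
definition smat_mult :: "smat \<Rightarrow> smat \<Rightarrow> smat" (infixl "\<star>" 70) where
  "A \<star> B = (\<lambda>i j. Sum_any (\<lambda>k. A i k * B k j))"

definition smat_vec :: "smat \<Rightarrow> svec \<Rightarrow> svec" (infixr "\<star>\<^sub>v" 69) where
  "A \<star>\<^sub>v v = (\<lambda>i. Sum_any (\<lambda>k. A i k * v k))"

definition smat_transpose :: "smat \<Rightarrow> smat" where
  "smat_transpose A = (\<lambda>i j. A j i)"

definition smat_diag :: "svec \<Rightarrow> smat" where
  "smat_diag h = (\<lambda>i j. if i = j then h i else 0)"

definition lower_triangular :: "smat \<Rightarrow> bool" where
  "lower_triangular A \<longleftrightarrow> (\<forall>i j. i < j \<longrightarrow> A i j = 0)"

definition lower_unitriangular :: "smat \<Rightarrow> bool" where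
  "lower_unitriangular A \<longleftrightarrow> lower_triangular A \<and> (\<forall>i. A i i = 1)"

(* Two-sided inverse in the algebra of lower triangular matrices; it exists and is unique for a
   lower triangular matrix without zeros on the diagonal.  It is only applied to such matrices. *)
definition smat_inv :: "smat \<Rightarrow> smat" where
  "smat_inv A = (THE B. lower_triangular B \<and> A \<star> B = smat_diag (\<lambda>_. 1) \<and> B \<star> A = smat_diag (\<lambda>_. 1))"

definition mono_vec :: "real \<Rightarrow> svec" where
  "mono_vec x = (\<lambda>n. x ^ n)"

definition mono_vec1 :: "real \<Rightarrow> svec" where
  "mono_vec1 x = (\<lambda>n. if even n then x ^ (n div 2) else 0)"

definition mono_vec2 :: "real \<Rightarrow> svec" where
  "mono_vec2 x = (\<lambda>n. if odd n then x ^ (n div 2) else 0)"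

definition moment_matrix ::
  "real measure \<Rightarrow> real set \<Rightarrow> (real \<Rightarrow> real) \<Rightarrow> (real \<Rightarrow> real) \<Rightarrow> smat" where
  "moment_matrix \<mu> \<Delta> u1 u2 =
     (\<lambda>i j. LINT x:\<Delta>|\<mu>. mono_vec x i * (mono_vec1 x j * u1 x + mono_vec2 x j * u2 x))"

(* g = S^(-1) H St^(-T), with H = diag(h 0, h 1, ...) *)
definition gauss_borel :: "smat \<Rightarrow> smat \<Rightarrow> svec \<Rightarrow> smat \<Rightarrow> bool" where
  "gauss_borel g S h St \<longleftrightarrow>
     lower_unitriangular S \<and> lower_unitriangular St \<and> (\<forall>n. h n \<noteq> 0) \<and>
     g = smat_inv S \<star> smat_diag h \<star> smat_transpose (smat_inv St)"

definition B_vec :: "smat \<Rightarrow> real \<Rightarrow> svec" where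
  "B_vec S x = S \<star>\<^sub>v mono_vec x"

definition A1_vec :: "svec \<Rightarrow> smat \<Rightarrow> real \<Rightarrow> svec" where
  "A1_vec h St x = smat_inv (smat_diag h) \<star>\<^sub>v St \<star>\<^sub>v mono_vec1 x"

definition A2_vec :: "svec \<Rightarrow> smat \<Rightarrow> real \<Rightarrow> svec" where
  "A2_vec h St x = smat_inv (smat_diag h) \<star>\<^sub>v St \<star>\<^sub>v mono_vec2 x"

definition Q_vec ::
  "(real \<Rightarrow> real) \<Rightarrow> (real \<Rightarrow> real) \<Rightarrow> svec \<Rightarrow> smat \<Rightarrow> real \<Rightarrow> svec" where
  "Q_vec u1 u2 h St x = (\<lambda>n. u1 x * A1_vec h St x n + u2 x * A2_vec h St x n)"

end

theory Submission
  imports Defs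
begin

text \<open>Passing from \<open>(w1, w2)\<close> to \<open>(w2, x w1)\<close> deletes the first column of the moment matrix: with
  the shift matrix \<open>\<Lambda>\<close>, \<open>g' = g \<Lambda>\<^sup>T\<close>. Put \<open>L = St\<^sup>-\<^sup>1 H\<close>, so that \<open>S g = L\<^sup>T\<close>, and likewise
  \<open>S' g' = L'\<^sup>T\<close>. Then \<open>\<Omega> L'\<^sup>T = S g' = L\<^sup>T \<Lambda>\<^sup>T\<close>, that is \<open>\<Omega>\<^sup>T = L'\<^sup>-\<^sup>1 \<Lambda> L\<close>. It is the transpose
  of a lower unitriangular matrix, and \<open>L'\<^sup>-\<^sup>1 \<Lambda> L\<close> vanishes above the first superdiagonal, so \<open>\<Omega>\<^sup>T\<close> is
  upper bidiagonal. Multiplying by \<open>L\<^sup>-\<^sup>1\<close> gives \<open>\<Omega>\<^sup>T H\<^sup>-\<^sup>1 St = H'\<^sup>-\<^sup>1 St' \<Lambda>\<close>, and the connection formulas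
  follow from \<open>\<Lambda> X\<^sub>1 = x X\<^sub>2\<close> and \<open>\<Lambda> X\<^sub>2 = X\<^sub>1\<close>.\<close>

section \<open>Row-finite matrices and associativity of products\<close>

text \<open>With a row-finite left factor every entry of a product is a finite sum, whatever the
  right factor is, so the default value of \<open>Sum_any\<close> on infinite supports never
  intervenes.\<close>

definition row_finite :: "smat \<Rightarrow> bool" where
  "row_finite A \<longleftrightarrow> (\<forall>i. finite {k. A i k \<noteq> 0})"

abbreviation smat_one :: smat where
  "smat_one \<equiv> smat_diag (\<lambda>_. 1)"

definition smat_shift :: smat where
  "smat_shift = (\<lambda>i j. if j = Suc i then 1 else 0)"

lemma smat_mult_eq_sum:
  assumes "finite K" "{k. A i k \<noteq> 0} \<subseteq> K"
  shows "(A \<star> B) i j = (\<Sum>k\<in>K. A i k * B k j)"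
  unfolding smat_mult_def using assms by (intro Sum_any.expand_superset) auto

lemma row_finite_smat_mult_eq_sum:
  assumes "row_finite A"
  shows "(A \<star> B) i j = (\<Sum>k\<in>{k. A i k \<noteq> 0}. A i k * B k j)"
  using assms by (intro smat_mult_eq_sum) (auto simp: row_finite_def)

lemma smat_mult_eq_single:
  assumes "\<And>k. k \<noteq> m \<Longrightarrow> A i k * B k j = 0"
  shows "(A \<star> B) i j = A i m * B m j"
proof -
  have "(A \<star> B) i j = (\<Sum>k\<in>{m}. A i k * B k j)"
    unfolding smat_mult_def using assms by (intro Sum_any.expand_superset) auto
  then show ?thesis by simp
qed

lemma row_finite_smat_mult:
  assumes A: "row_finite A" and B: "row_finite B"
  shows "row_finite (A \<star> B)"
  unfolding row_finite_def
proof
  fix i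
  let ?K = "{k. A i k \<noteq> 0}"
  have fin: "finite ?K" using A by (simp add: row_finite_def)
  have "{j. (A \<star> B) i j \<noteq> 0} \<subseteq> (\<Union>k\<in>?K. {j. B k j \<noteq> 0})"
  proof
    fix j assume "j \<in> {j. (A \<star> B) i j \<noteq> 0}"
    then have "(\<Sum>k\<in>?K. A i k * B k j) \<noteq> 0"
      using row_finite_smat_mult_eq_sum[OF A, of B i j] by simp
    then obtain k where "k \<in> ?K" "A i k * B k j \<noteq> 0"
      by (rule sum.not_neutral_contains_not_neutral)
    then show "j \<in> (\<Union>k\<in>?K. {j. B k j \<noteq> 0})" by auto
  qed
  moreover have "finite (\<Union>k\<in>?K. {j. B k j \<noteq> 0})"
    using fin B by (auto simp: row_finite_def)
  ultimately show "finite {j. (A \<star> B) i j \<noteq> 0}" by (rule finite_subset)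
qed

text \<open>Both bracketings are the same finite double sum. \<open>C\<close> stays arbitrary so
  that matrices that need not be row-finite, such as the moment matrix, can stand last.\<close>

lemma smat_mult_assoc:
  assumes A: "row_finite A" and B: "row_finite B"
  shows "A \<star> B \<star> C = A \<star> (B \<star> C)"
proof (intro ext)
  fix i j
  let ?K = "{k. A i k \<noteq> 0}"
  \<comment> \<open>\<open>?M\<close> contains the support of row \<open>i\<close> of
    \<open>A \<star> B\<close> and of every row of \<open>B\<close> with index in \<open>?K\<close>,
    so one finite set serves for the outer and all inner sums.\<close>
  let ?M = "\<Union>k\<in>?K. {l. B k l \<noteq> 0}"
  have K: "finite ?K" using A by (simp add: row_finite_def)
  have M: "finite ?M" using K B by (auto simp: row_finite_def)
  have AB: "(A \<star> B) i l = (\<Sum>k\<in>?K. A i k * B k l)" for l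
    by (rule row_finite_smat_mult_eq_sum[OF A])
  have "{l. (A \<star> B) i l \<noteq> 0} \<subseteq> ?M"
    unfolding AB by (auto elim!: sum.not_neutral_contains_not_neutral)
  then have "(A \<star> B \<star> C) i j = (\<Sum>l\<in>?M. (\<Sum>k\<in>?K. A i k * B k l) * C l j)"
    using smat_mult_eq_sum[OF M, of "A \<star> B" i C j] by (simp add: AB)
  also have "\<dots> = (\<Sum>k\<in>?K. \<Sum>l\<in>?M. A i k * (B k l * C l j))"
    unfolding sum_distrib_right by (subst sum.swap) (simp add: mult.assoc)
  also have "\<dots> = (\<Sum>k\<in>?K. A i k * (\<Sum>l\<in>?M. B k l * C l j))"
    by (simp add: sum_distrib_left)
  also have "\<dots> = (\<Sum>k\<in>?K. A i k * (B \<star> C) k j)"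
  proof (intro sum.cong refl)
    fix k assume "k \<in> ?K"
    then have "{l. B k l \<noteq> 0} \<subseteq> ?M" by blast
    then show "A i k * (\<Sum>l\<in>?M. B k l * C l j) = A i k * (B \<star> C) k j"
      using smat_mult_eq_sum[OF M, of B k C j] by simp
  qed
  also have "\<dots> = (A \<star> (B \<star> C)) i j"
    by (rule row_finite_smat_mult_eq_sum[OF A, symmetric])
  finally show "(A \<star> B \<star> C) i j = (A \<star> (B \<star> C)) i j" .
qed

text \<open>A vector becomes a matrix all of whose columns equal it; facts on matrix-vector products
  then reduce to matrix products, read off in any column \<open>j\<close>.\<close>

lemma smat_vec_eq_smat_mult: "(A \<star>\<^sub>v v) i = (A \<star> (\<lambda>k _. v k)) i j"
  by (simp add: smat_vec_def smat_mult_def)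

lemma smat_vec_assoc:
  assumes "row_finite A" "row_finite B"
  shows "A \<star> B \<star>\<^sub>v v = A \<star>\<^sub>v B \<star>\<^sub>v v"
proof
  fix i
  have "(\<lambda>k _. (B \<star>\<^sub>v v) k) = B \<star> (\<lambda>k _. v k)"
    by (intro ext) (rule smat_vec_eq_smat_mult)
  then show "(A \<star> B \<star>\<^sub>v v) i = (A \<star>\<^sub>v B \<star>\<^sub>v v) i"
    by (simp add: smat_vec_eq_smat_mult[where j = 0] smat_mult_assoc[OF assms])
qed

section \<open>Diagonal matrices, shift and transpose\<close>

lemma smat_mult_diag_left: "(smat_diag d \<star> A) i j = d i * A i j"
  by (subst smat_mult_eq_single[where m = i]) (auto simp: smat_diag_def)

lemma smat_mult_diag_right: "(A \<star> smat_diag d) i j = A i j * d j"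
  by (subst smat_mult_eq_single[where m = j]) (auto simp: smat_diag_def)

lemma smat_mult_one_left [simp]: "smat_one \<star> A = A"
  by (intro ext) (simp add: smat_mult_diag_left)

lemma smat_mult_one_right [simp]: "A \<star> smat_one = A"
  by (intro ext) (simp add: smat_mult_diag_right)

lemma smat_mult_shift_left: "smat_shift \<star> A = (\<lambda>i. A (Suc i))"
  by (intro ext, subst smat_mult_eq_single) (auto simp: smat_shift_def)

lemma smat_shift_vec: "smat_shift \<star>\<^sub>v v = (\<lambda>i. v (Suc i))"
  by (intro ext) (simp add: smat_vec_eq_smat_mult[where j = 0] smat_mult_shift_left)

text \<open>Both sides are \<open>Sum_any\<close> of the same family, so they agree even where it
  takes its default value.\<close>

lemma smat_transpose_mult:
  "smat_transpose (A \<star> B) = smat_transpose B \<star> smat_transpose A"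
  by (simp add: smat_transpose_def smat_mult_def mult.commute)

lemma smat_transpose_transpose [simp]: "smat_transpose (smat_transpose A) = A"
  by (simp add: smat_transpose_def)

lemma smat_transpose_diag [simp]: "smat_transpose (smat_diag d) = smat_diag d"
  by (auto simp: smat_transpose_def smat_diag_def fun_eq_iff)

section \<open>Lower triangular matrices and their inverses\<close>

lemma row_finite_lower_triangular:
  assumes "lower_triangular A" shows "row_finite A"
  unfolding row_finite_def
proof
  fix i
  have "{k. A i k \<noteq> 0} \<subseteq> {..i}"
    using assms by (auto simp: lower_triangular_def not_less[symmetric])
  then show "finite {k. A i k \<noteq> 0}" by (rule finite_subset) simp
qed

lemma row_finite_shift: "row_finite smat_shift"
  by (simp add: row_finite_def smat_shift_def)

lemma lower_triangular_diag: "lower_triangular (smat_diag d)"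
  by (simp add: lower_triangular_def smat_diag_def)

lemma smat_mult_lower_triangular_eq_sum:
  assumes "lower_triangular A"
  shows "(A \<star> B) i j = (\<Sum>k\<le>i. A i k * B k j)"
  using assms by (intro smat_mult_eq_sum) (auto simp: lower_triangular_def not_less[symmetric])

lemma lower_triangular_smat_mult:
  assumes "lower_triangular A" "lower_triangular B"
  shows "lower_triangular (A \<star> B)"
  using assms by (auto simp: lower_triangular_def smat_mult_lower_triangular_eq_sum[OF assms(1)])

lemma smat_mult_diagonal_entry:
  assumes "lower_triangular A" "lower_triangular B"
  shows "(A \<star> B) i i = A i i * B i i"
  using assms by (intro smat_mult_eq_single) (metis lower_triangular_def mult_eq_0_iff neqE)

text \<open>Solves \<open>A \<star> B = smat_one\<close> for \<open>B\<close> row by row: entry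
  \<open>i j\<close> of this equation is solved for \<open>B i j\<close>, the earlier rows being
  known.\<close>

function forward_substitution :: "smat \<Rightarrow> smat" where
  "forward_substitution A i j =
     (smat_one i j - (\<Sum>k<i. A i k * forward_substitution A k j)) / A i i"
  by auto
termination by (relation "inv_image less_than (\<lambda>(A, i, j). i)") auto

declare forward_substitution.simps [simp del]

text \<open>The nonzero diagonal of \<open>B\<close> is recorded so that the lemma can be applied
  once more, to \<open>B\<close> itself.\<close>

lemma lower_triangular_right_inverse:
  assumes A: "lower_triangular A" and nz: "\<And>i. A i i \<noteq> 0"
  shows "\<exists>B. lower_triangular B \<and> (\<forall>i. B i i \<noteq> 0) \<and> A \<star> B = smat_one"
proof (intro exI conjI allI)
  let ?B = "forward_substitution A"
  \<comment> \<open>For \<open>k < i < j\<close> the entries \<open>?B k j\<close> vanish by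
    induction, and so does the entry of the identity.\<close>
  have "i < j \<Longrightarrow> ?B i j = 0" for i j
    by (induction i rule: less_induct)
      (subst forward_substitution.simps, auto simp: smat_diag_def)
  then show B: "lower_triangular ?B" by (simp add: lower_triangular_def)
  show eq: "A \<star> ?B = smat_one"
  proof (intro ext)
    fix i j
    have "(A \<star> ?B) i j = (\<Sum>k<i. A i k * ?B k j) + A i i * ?B i j"
      unfolding smat_mult_lower_triangular_eq_sum[OF A] by (simp flip: lessThan_Suc_atMost)
    \<comment> \<open>Only the isolated entry \<open>?B i j\<close> is unfolded, not those under the
      sum; multiplying by \<open>A i i\<close> cancels the division.\<close>
    also have "\<dots> = smat_one i j"
      by (subst (2) forward_substitution.simps) (simp add: nz)
    finally show "(A \<star> ?B) i j = smat_one i j" .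
  qed
  show "?B i i \<noteq> 0" for i
    using smat_mult_diagonal_entry[OF A B, of i] by (auto simp: eq smat_diag_def)
qed

text \<open>A right inverse \<open>B\<close> of \<open>A\<close> has a right inverse
  \<open>C\<close> of its own, and \<open>C = A\<close> makes \<open>B\<close> two-sided. Uniqueness
  then makes the description in \<open>smat_inv\<close> meaningful.\<close>

lemma smat_inv:
  assumes A: "lower_triangular A" and nz: "\<And>i. A i i \<noteq> 0"
  shows lower_triangular_smat_inv: "lower_triangular (smat_inv A)"
    and smat_mult_inv_right: "A \<star> smat_inv A = smat_one"
    and smat_mult_inv_left: "smat_inv A \<star> A = smat_one"
proof -
  obtain B where B: "lower_triangular B" "\<And>i. B i i \<noteq> 0" "A \<star> B = smat_one"
    using lower_triangular_right_inverse[OF A nz] by blast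
  obtain C where C: "B \<star> C = smat_one"
    using lower_triangular_right_inverse[OF B(1,2)] by blast
  have rf: "row_finite A" "row_finite B"
    using A B(1) by (auto intro: row_finite_lower_triangular)
  \<comment> \<open>Evaluate \<open>A \<star> B \<star> C\<close> in both bracketings.\<close>
  have "C = A"
    using smat_mult_assoc[OF rf, of C] by (simp add: B(3) C)
  then have BA: "B \<star> A = smat_one" using C by simp
  have "lower_triangular (smat_inv A) \<and> A \<star> smat_inv A = smat_one \<and> smat_inv A \<star> A = smat_one"
    unfolding smat_inv_def
  proof (rule theI[where P = "\<lambda>B. lower_triangular B \<and> A \<star> B = smat_one \<and> B \<star> A = smat_one"])
    show "lower_triangular B \<and> A \<star> B = smat_one \<and> B \<star> A = smat_one"
      using B BA by simp
    fix D assume D: "lower_triangular D \<and> A \<star> D = smat_one \<and> D \<star> A = smat_one"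
    then show "D = B"
      using smat_mult_assoc[OF rf(2,1), of D] by (simp add: BA)
  qed
  then show "lower_triangular (smat_inv A)" "A \<star> smat_inv A = smat_one" "smat_inv A \<star> A = smat_one"
    by simp_all
qed

lemma smat_inv_diagonal_entry:
  assumes A: "lower_triangular A" and nz: "\<And>i. A i i \<noteq> 0"
  shows "smat_inv A i i = 1 / A i i"
  using smat_mult_diagonal_entry[OF A lower_triangular_smat_inv[OF A nz], of i] nz[of i]
  by (simp add: smat_mult_inv_right[OF A nz] smat_diag_def field_simps)

lemma lower_triangular_smat_inv_diag:
  assumes "\<And>i. d i \<noteq> 0"
  shows "lower_triangular (smat_inv (smat_diag d))"
  by (rule lower_triangular_smat_inv[OF lower_triangular_diag]) (simp add: smat_diag_def assms)

section \<open>The shift on moments and monomial vectors; linearity\<close>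

text \<open>The integrands agree pointwise, since
  \<open>mono_vec1 x (Suc j) = x * mono_vec2 x j\<close> and
  \<open>mono_vec2 x (Suc j) = mono_vec1 x j\<close>.\<close>

lemma moment_matrix_shift:
  "moment_matrix \<mu> \<Delta> w2 (\<lambda>x. x * w1 x) i j = moment_matrix \<mu> \<Delta> w1 w2 i (Suc j)"
proof -
  have "mono_vec1 x j * w2 x + mono_vec2 x j * (x * w1 x) =
        mono_vec1 x (Suc j) * w1 x + mono_vec2 x (Suc j) * w2 x" for x
    by (auto simp: mono_vec1_def mono_vec2_def elim!: evenE oddE)
  then show ?thesis by (simp add: moment_matrix_def)
qed

lemma shift_mono_vec1: "smat_shift \<star>\<^sub>v mono_vec1 x = (\<lambda>n. x * mono_vec2 x n)"
  by (auto simp: smat_shift_vec mono_vec1_def mono_vec2_def elim!: evenE oddE)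

lemma shift_mono_vec2: "smat_shift \<star>\<^sub>v mono_vec2 x = mono_vec1 x"
  by (auto simp: smat_shift_vec mono_vec1_def mono_vec2_def elim!: evenE oddE)

lemma smat_vec_scale: "A \<star>\<^sub>v (\<lambda>n. c * v n) = (\<lambda>n. c * (A \<star>\<^sub>v v) n)" if "row_finite A"
proof
  fix i
  show "(A \<star>\<^sub>v (\<lambda>n. c * v n)) i = c * (A \<star>\<^sub>v v) i"
    by (simp add: smat_vec_eq_smat_mult[where j = 0] row_finite_smat_mult_eq_sum[OF that]
        sum_distrib_left mult.left_commute)
qed

lemma smat_vec_add:
  "A \<star>\<^sub>v (\<lambda>n. u n + v n) = (\<lambda>n. (A \<star>\<^sub>v u) n + (A \<star>\<^sub>v v) n)" if "row_finite A"
proof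
  fix i
  show "(A \<star>\<^sub>v (\<lambda>n. u n + v n)) i = (A \<star>\<^sub>v u) i + (A \<star>\<^sub>v v) i"
    by (simp add: smat_vec_eq_smat_mult[where j = 0] row_finite_smat_mult_eq_sum[OF that]
        sum.distrib distrib_left)
qed

section \<open>Algebra of the connection matrix\<close>

lemma gauss_borel_left_mult:
  assumes "gauss_borel g S h St"
  shows "S \<star> g = smat_transpose (smat_inv St \<star> smat_diag h)"
proof -
  have S: "lower_triangular S" "\<And>i. S i i \<noteq> 0"
    and g: "g = smat_inv S \<star> smat_diag h \<star> smat_transpose (smat_inv St)"
    using assms by (auto simp: gauss_borel_def lower_unitriangular_def)
  note rf = row_finite_lower_triangular
  \<comment> \<open>The upper triangular factor need not be row-finite, so the rebracketing keeps it
    rightmost.\<close>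
  have "S \<star> g = S \<star> smat_inv S \<star> (smat_diag h \<star> smat_transpose (smat_inv St))"
    unfolding g using S lower_triangular_smat_inv[OF S]
    by (simp add: smat_mult_assoc rf lower_triangular_diag)
  then show ?thesis
    by (simp add: smat_mult_inv_right[OF S] smat_transpose_mult)
qed

text \<open>Purely algebraic core: measure and weights enter only through the deletion of the first
  column of \<open>g\<close>.\<close>

lemma gauss_borel_column_shift:
  assumes gb: "gauss_borel g S h St" and gb': "gauss_borel g' S' h' St'"
    and shift: "\<And>i j. g' i j = g i (Suc j)"
  defines "\<Omega> \<equiv> S \<star> smat_inv S'"
  shows "\<Omega> n n = 1"
    and "\<Omega> (Suc n) n = h (Suc n) / h' n"
    and "m \<noteq> n \<Longrightarrow> m \<noteq> Suc n \<Longrightarrow> \<Omega> m n = 0"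
    and "\<Omega> \<star> S' = S"
    and "row_finite (smat_transpose \<Omega>)"
    and "smat_transpose \<Omega> \<star> (smat_inv (smat_diag h) \<star> St) =
         smat_inv (smat_diag h') \<star> St' \<star> smat_shift"
proof -
  \<comment> \<open>\<open>P\<close> and \<open>P'\<close> invert \<open>L\<close> and
    \<open>L'\<close>; they are also the matrices applied to the monomial vectors in
    \<open>A1_vec\<close> and \<open>A2_vec\<close>.\<close>
  define L where "L = smat_inv St \<star> smat_diag h"
  define L' where "L' = smat_inv St' \<star> smat_diag h'"
  define P where "P = smat_inv (smat_diag h) \<star> St"
  define P' where "P' = smat_inv (smat_diag h') \<star> St'"
  have tri: "lower_triangular S" "lower_triangular S'" "lower_triangular St" "lower_triangular St'"
    and unit: "S i i = 1" "S' i i = 1" "St i i = 1" "St' i i = 1"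
    and h: "h i \<noteq> 0" "h' i \<noteq> 0" for i
    using gb gb' by (auto simp: gauss_borel_def lower_unitriangular_def)
  have dh: "smat_diag h i i \<noteq> 0" "smat_diag h' i i \<noteq> 0" for i
    using h by (auto simp: smat_diag_def)
  note D = lower_triangular_diag[of h] lower_triangular_diag[of h']
  have inv_tri: "lower_triangular (smat_inv S')" "lower_triangular (smat_inv St)"
      "lower_triangular (smat_inv St')"
      "lower_triangular (smat_inv (smat_diag h))" "lower_triangular (smat_inv (smat_diag h'))"
    using tri unit D dh by (auto intro!: lower_triangular_smat_inv)
  note rf = tri[THEN row_finite_lower_triangular] inv_tri[THEN row_finite_lower_triangular]
    D[THEN row_finite_lower_triangular] row_finite_shift
  have L: "lower_triangular L" "lower_triangular L'" "lower_triangular P" "lower_triangular P'"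
    unfolding L_def L'_def P_def P'_def using tri inv_tri D
    by (auto intro!: lower_triangular_smat_mult)
  note rfL = L[THEN row_finite_lower_triangular]
  have \<Omega>_tri: "lower_triangular \<Omega>"
    unfolding \<Omega>_def by (rule lower_triangular_smat_mult[OF tri(1) inv_tri(1)])
  show "\<Omega> n n = 1"
    unfolding \<Omega>_def smat_mult_diagonal_entry[OF tri(1) inv_tri(1)]
    using smat_inv_diagonal_entry[OF tri(2)] by (simp add: unit)
  show \<Omega>S': "\<Omega> \<star> S' = S"
    unfolding \<Omega>_def using smat_mult_inv_left[OF tri(2)] by (simp add: smat_mult_assoc rf unit)
  have Sg: "S \<star> g = smat_transpose L" and Sg': "S' \<star> g' = smat_transpose L'"
    unfolding L_def L'_def using gauss_borel_left_mult gb gb' by auto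
  \<comment> \<open>\<open>\<Omega> \<star> (S' \<star> g')\<close> is evaluated in two ways.
    Working with transposes keeps the row-finite \<open>\<Omega>\<close> and \<open>S'\<close> on
    the left of \<open>g'\<close>.\<close>
  have "smat_transpose (L' \<star> smat_transpose \<Omega>) = \<Omega> \<star> (S' \<star> g')"
    by (simp add: Sg' smat_transpose_mult)
  also have "\<dots> = S \<star> g'"
    using \<Omega>_tri by (simp add: \<Omega>S' rf row_finite_lower_triangular flip: smat_mult_assoc)
  also have "\<dots> = (\<lambda>i j. (S \<star> g) i (Suc j))"
    by (simp add: smat_mult_def shift)
  also have "\<dots> = smat_transpose (smat_shift \<star> L)"
    by (simp add: Sg smat_mult_shift_left) (simp add: smat_transpose_def)
  finally have L'\<Omega>: "L' \<star> smat_transpose \<Omega> = smat_shift \<star> L"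
    by (metis smat_transpose_transpose)
  \<comment> \<open>One side of each inverse relation suffices: \<open>P' \<star> L'\<close> cancels
    on the left of \<Omega>'s equation, \<open>L \<star> P\<close> on the right.\<close>
  have "P' \<star> L' = smat_inv (smat_diag h') \<star> (St' \<star> smat_inv St' \<star> smat_diag h')"
    unfolding P'_def L'_def by (simp add: smat_mult_assoc row_finite_smat_mult rf)
  also have "\<dots> = smat_one"
    using smat_mult_inv_right[OF tri(4)] smat_mult_inv_left[OF D(2)] by (simp add: unit dh)
  finally have P'L': "P' \<star> L' = smat_one" .
  have "L \<star> P = smat_inv St \<star> (smat_diag h \<star> smat_inv (smat_diag h) \<star> St)"
    unfolding P_def L_def by (simp add: smat_mult_assoc row_finite_smat_mult rf)
  also have "\<dots> = smat_one"
    using smat_mult_inv_left[OF tri(3)] smat_mult_inv_right[OF D(1)] by (simp add: unit dh)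
  finally have LP: "L \<star> P = smat_one" .
  have \<Omega>_eq: "smat_transpose \<Omega> = P' \<star> (smat_shift \<star> L)"
    by (simp add: P'L' rfL flip: L'\<Omega> smat_mult_assoc)
  \<comment> \<open>Triangularity of \<open>\<Omega>\<close> only makes its own rows finite; those
    of the transpose are finite because all three factors in \<open>\<Omega>_eq\<close> are
    row-finite.\<close>
  show \<Omega>_rf: "row_finite (smat_transpose \<Omega>)"
    unfolding \<Omega>_eq by (intro row_finite_smat_mult rf rfL)
  have "smat_transpose \<Omega> \<star> P = P' \<star> (smat_shift \<star> (L \<star> P))"
    unfolding \<Omega>_eq by (simp add: smat_mult_assoc row_finite_smat_mult rf rfL)
  then show "smat_transpose \<Omega> \<star> (smat_inv (smat_diag h) \<star> St) =
             smat_inv (smat_diag h') \<star> St' \<star> smat_shift"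
    unfolding LP by (simp add: P_def P'_def)
  have \<Omega>_entry: "\<Omega> m n = (P' \<star> (\<lambda>k. L (Suc k))) n m" for m n
    using fun_cong[OF fun_cong[OF \<Omega>_eq], of n m]
    by (simp add: smat_mult_shift_left smat_transpose_def)
  \<comment> \<open>A surviving term needs \<open>k \<le> n\<close> and
    \<open>m \<le> Suc k\<close>: for \<open>m = Suc n\<close> only \<open>k = n\<close> is left,
    and for larger \<open>m\<close> nothing.\<close>
  have P'L_zero: "P' n k * L (Suc k) m = 0" if "n < k \<or> Suc k < m" for k m n
    using that L by (auto simp: lower_triangular_def)
  have "\<Omega> (Suc n) n = P' n n * L (Suc n) (Suc n)"
    unfolding \<Omega>_entry by (intro smat_mult_eq_single P'L_zero) auto
  also have "P' n n = 1 / h' n"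
    unfolding P'_def using smat_inv_diagonal_entry[OF D(2)] dh
    by (simp add: smat_mult_diagonal_entry inv_tri tri unit) (simp add: smat_diag_def)
  also have "L (Suc n) (Suc n) = h (Suc n)"
    unfolding L_def using smat_inv_diagonal_entry[OF tri(3)]
    by (simp add: smat_mult_diag_right unit)
  finally show "\<Omega> (Suc n) n = h (Suc n) / h' n" by simp
  assume "m \<noteq> n" "m \<noteq> Suc n"
  then consider "m < n" | "Suc n < m" by linarith
  then show "\<Omega> m n = 0"
  proof cases
    case 1
    then show ?thesis using \<Omega>_tri by (simp add: lower_triangular_def)
  next
    case 2
    then show ?thesis
      unfolding \<Omega>_entry smat_mult_lower_triangular_eq_sum[OF L(4)]
      by (intro sum.neutral ballI P'L_zero) auto
  qed
qed

section \<open>Connection formulas\<close>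

theorem theorem6:
  fixes \<Delta> :: "real set" and \<mu> :: "real measure"
    and w1 w2 v1 v2 :: "real \<Rightarrow> real"
    and S St S' St' \<Omega> :: smat and h h' :: svec
  assumes interval: "is_interval \<Delta>"
    and borel: "sets \<mu> = sets borel"
    and support: "emeasure \<mu> (- \<Delta>) = 0"
    and moments1: "\<And>k. set_integrable \<mu> \<Delta> (\<lambda>x. x ^ k * w1 x)"
    and moments2: "\<And>k. set_integrable \<mu> \<Delta> (\<lambda>x. x ^ k * w2 x)"
    and v1: "v1 = w2" and v2: "v2 = (\<lambda>x. x * w1 x)"
    and gb: "gauss_borel (moment_matrix \<mu> \<Delta> w1 w2) S h St"
    and gb': "gauss_borel (moment_matrix \<mu> \<Delta> v1 v2) S' h' St'"
    and \<Omega>: "\<Omega> = S \<star> smat_inv S'"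
  shows "(\<forall>n. \<Omega> n n = 1) \<and>
         (\<forall>n. \<Omega> (Suc n) n = h (Suc n) / h' n) \<and>
         (\<forall>m n. m \<noteq> n \<and> m \<noteq> Suc n \<longrightarrow> \<Omega> m n = 0) \<and>
         (\<forall>x. \<Omega> \<star>\<^sub>v B_vec S' x = B_vec S x) \<and>
         (\<forall>x. smat_transpose \<Omega> \<star>\<^sub>v A1_vec h St x = (\<lambda>n. x * A2_vec h' St' x n)) \<and>
         (\<forall>x. smat_transpose \<Omega> \<star>\<^sub>v A2_vec h St x = A1_vec h' St' x) \<and>
         (\<forall>x\<in>\<Delta>. smat_transpose \<Omega> \<star>\<^sub>v Q_vec w1 w2 h St x = Q_vec v1 v2 h' St' x)"
proof -
  have shift: "moment_matrix \<mu> \<Delta> v1 v2 i j = moment_matrix \<mu> \<Delta> w1 w2 i (Suc j)" for i j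
    unfolding v1 v2 by (rule moment_matrix_shift)
  note conn = gauss_borel_column_shift[OF gb gb' shift, folded \<Omega>]
  have rf: "row_finite S'" "row_finite St" "row_finite St'" "row_finite \<Omega>"
    "row_finite (smat_inv (smat_diag h))" "row_finite (smat_inv (smat_diag h'))"
  proof -
    have "lower_triangular S'" "lower_triangular St" "lower_triangular St'"
      and "h i \<noteq> 0" "h' i \<noteq> 0" for i
      using gb gb' by (auto simp: gauss_borel_def lower_unitriangular_def)
    moreover from this
    have "lower_triangular (smat_inv (smat_diag h))" "lower_triangular (smat_inv (smat_diag h'))"
      by (auto intro!: lower_triangular_smat_inv_diag)
    moreover have "lower_triangular \<Omega>"
      using conn(3) by (simp add: lower_triangular_def)
    ultimately show "row_finite S'" "row_finite St" "row_finite St'" "row_finite \<Omega>"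
      "row_finite (smat_inv (smat_diag h))" "row_finite (smat_inv (smat_diag h'))"
      by (auto intro: row_finite_lower_triangular)
  qed
  \<comment> \<open>The matrix identity applied to an arbitrary vector, bracketed as in
    \<open>A1_vec\<close> and \<open>A2_vec\<close>, so that the shift meets the monomial vector
    first.\<close>
  have \<Omega>_vec: "smat_transpose \<Omega> \<star>\<^sub>v smat_inv (smat_diag h) \<star>\<^sub>v St \<star>\<^sub>v v =
      smat_inv (smat_diag h') \<star>\<^sub>v St' \<star>\<^sub>v smat_shift \<star>\<^sub>v v" for v
    by (simp add: conn(6) rf row_finite_shift conn(5) row_finite_smat_mult
        flip: smat_vec_assoc smat_mult_assoc)
  have B: "\<Omega> \<star>\<^sub>v B_vec S' x = B_vec S x" for x
    unfolding B_vec_def by (simp add: rf conn(4) flip: smat_vec_assoc)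
  have A1: "smat_transpose \<Omega> \<star>\<^sub>v A1_vec h St x = (\<lambda>n. x * A2_vec h' St' x n)" for x
    unfolding A1_vec_def A2_vec_def \<Omega>_vec shift_mono_vec1 by (simp add: smat_vec_scale rf)
  have A2: "smat_transpose \<Omega> \<star>\<^sub>v A2_vec h St x = A1_vec h' St' x" for x
    unfolding A1_vec_def A2_vec_def \<Omega>_vec shift_mono_vec2 ..
  \<comment> \<open>By linearity the left side is \<open>w1 x\<close> times the \<open>A1\<close>
    formula plus \<open>w2 x\<close> times the \<open>A2\<close> formula; the factor
    \<open>x\<close> from the former turns \<open>w1\<close> into \<open>v2\<close>.\<close>
  have Q: "smat_transpose \<Omega> \<star>\<^sub>v Q_vec w1 w2 h St x = Q_vec v1 v2 h' St' x" for x
    unfolding Q_vec_def smat_vec_add[OF conn(5)] smat_vec_scale[OF conn(5)] A1 A2 v1 v2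
    by (simp add: algebra_simps)
  show ?thesis
    using conn(1-3) B A1 A2 Q by blast
qed

end
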